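(* Let $c\in[0,\frac12]$ and let $x\in\mathbb{Q}\cap[c,1]$, $x\ne0$. (i) Suppose that there exists an $\omega\in\{0,1\}^{\mathbb N}$ such that $T_{\omega,c}^n(x)\notin S$ for all $n\ge0$. Then $x$ has a unique $c$-Lüroth expansion, and it is ultimately periodic. (ii) Suppose that for each $y\in[c,1]$ the point $x$ admits at most one loop at $y$ (up to the equivalence $\sim$). Then all $c$-Lüroth expansions of $x$ are ultimately periodic, so there are at most countably many of them. (iii) Suppose there is a $y\in[c,1]$ such that $x$ admits at least two loops $\mathbf u_1\nsim\mathbf u_2$ at $y$. Then $x$ has uncountably many $c$-Lüroth expansions that are not ultimately periodic, and countably many ultimately periodic $c$-Lüroth expansions.
   Context: Let $T_L:[0,1]\to[0,1]$ be given by $T_L(0)=0$, $T_L(1)=1$ and $T_L(x)=\lceil \frac1x\rceil(\lceil \frac1x\rceil-1)x-(\lceil \frac1x\rceil-1)$ for $x\ne 0,1$, and let $T_A=1-T_L$. For $c\in[0,\frac12]$ put $z_n=\frac1n$ ($n\ge1$), $z_n^+=z_n+cz_nz_{n-1}$ ($n\ge 2$), $z_n^-=z_n-cz_nz_{n+1}$ ($n\ge1$). Maps $T_{0,c},T_{1,c}:[c,1]\to[c,1]$. For $c>0$: $T_{0,c}(x)=T_A(x)$ if $x\in\bigcup_{n\ge2}[z_n,z_n^+)$ and $T_{0,c}(x)=T_L(x)$ if $x\in\{1\}\cup\bigcup_{n\ge2}[z_n^+,z_{n-1})$; $T_{1,c}(x)=T_A(x)$ if $x\in\bigcup_{n\ge2}[z_n,z_{n-1}^-]$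 and $T_{1,c}(x)=T_L(x)$ if $x\in\{1\}\cup\bigcup_{n\ge2}(z_{n-1}^-,z_{n-1})$. For $c=0$: $T_{0,0}=T_L$ and $T_{1,0}=T_A$, except that $T_{0,0}(z_n)=T_{1,0}(z_n)=1$ for all $n\ge1$ and $T_{0,0}(0)=T_{1,0}(0)=1$. The switch region is $S=[c,1]\cap\bigcup_{n>1}[z_n^+,z_{n-1}^-]$ if $c>0$ and $S=(0,1]\setminus\{z_n:n\ge1\}$ if $c=0$. Let $L_c(\omega,x)=(\sigma(\omega),T_{\omega_1,c}(x))$ on $\{0,1\}^{\mathbb N}\times[c,1]$, $\sigma$ the left shift, and $T_{\omega,c}^n=T_{\omega_n,c}\circ\cdots\circ T_{\omega_1,c}$, $T^0_{\omega,c}=\mathrm{id}$. For $x\in[c,1]$, $x\ne0$, let $s_1(\omega,x)=\omega_1$ if $x\in S$; $s_1(\omega,x)=0$ if $x=1$ or $x\in\bigcup_{n\ge1}(z_n^-,z_n)$; $s_1(\omega,x)=1$ if $x\in\bigcup_{n\ge2}[z_n,z_n^+)$; and, when $c=0$, $s_1(\omega,z_n)=1$ for $n\ge2$. Let $d_1(\omega,x)=2$ if $x=1$ and $d_1(\omega,x)=n$ if $x\in[z_n,z_{n-1})$, $n\ge2$. For $i\ge1$ put $s_i(\omega,x)=s_1(L_c^{i-1}(\omega,x))$, $d_i(\omega,x)=d_1(L_c^{i-1}(\omega,x))$. The $c$-Lüroth expansions of $x$ are the distinct sequences $((s_i(\omega,x),d_i(\omega,x)))_{i\ge1}$, $\omega\in\{0,1\}^{\mathbb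 N}$. A sequence $(a_i)_{i\ge1}$ is ultimately periodic if there are $n\ge0$, $r\ge1$ with $a_{n+j}=a_{n+r+j}$ for all $j\ge1$. Loops: a finite string $\mathbf u$ of symbols in $\{0,1\}$ is a loop for $x\in[c,1]$ at the point $y\in[c,1]$ (and $x$ is said to admit the loop $\mathbf u$ at $y$) if there exist $\omega\in\{0,1\}^{\mathbb N}$, $n=n(\omega)\ge0$ and $r=r(\omega)\ge1$ with $\omega_{n+1}\cdots\omega_{n+r}=\mathbf u$, $T_{\omega,c}^n(x)=y=T_{\omega,c}^{n+r}(x)$ and $T^{n+j}_{\omega,c}(x)\ne y$ for $1\le j<r$. For two loops $\mathbf u_1,\mathbf u_2$ of $x$ at $y$, realised by sequences $\omega_1,\omega_2\in\{0,1\}^{\mathbb N}$ (that is, for each $k\in\{1,2\}$ there are $n(\omega_k)\ge0$ and $r(\omega_k)\ge1$ such that the block of symbols of the sequence $\omega_k$ in positions $n(\omega_k)+1,\ldots,n(\omega_k)+r(\omega_k)$ equals $\mathbf u_k$, $T_{\omega_k,c}^{n(\omega_k)}(x)=y=T_{\omega_k,c}^{n(\omega_k)+r(\omega_k)}(x)$ and $T_{\omega_k,c}^{n(\omega_k)+j}(x)\ne y$ for $1\le j<r(\omega_k)$), write $\mathbf u_1\sim\mathbf u_2$ if $r(\omega_1)=r(\omega_2)=:r$ and the strings of sign-digit pairs $(s_i(\omega_1,x),d_i(\omega_1,x))$, $n(\omega_1)+1\le i\le n(\omega_1)+r$, and $(s_i(\omega_2,x),d_i(\omega_2,x))$, $n(\omega_2)+1\le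 i\le n(\omega_2)+r$, coincide. Loops are counted up to this equivalence. *)

theory Defs
  imports Complex_Main "HOL-Library.Countable_Set" "HOL-Library.Z2"
begin

text \<open>
  The alphabet \<open>{0,1}\<close> is the type \<^typ>\<open>bit\<close>; its field structure plays no role.  Sequences
  \<open>(a_i)\<close>, \<open>i \<ge> 1\<close>, are functions on \<^typ>\<open>nat\<close> with \<open>a_i\<close> stored at index \<open>i - 1\<close>; in particular
  \<open>\<omega> 0\<close> is the first symbol of \<open>\<omega>\<close>.  The maps are total functions on the reals and are only
  meaningful on \<open>[c,1]\<close>.
\<close>

definition T_L :: "real \<Rightarrow> real" where
  "T_L x = (if x = 0 then 0 else if x = 1 then 1
            else of_int \<lceil>1/x\<rceil> * (of_int \<lceil>1/x\<rceil> - 1) * x - (of_int \<lceil>1/x\<rceil> - 1))"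

definition T_A :: "real \<Rightarrow> real" where
  "T_A x = 1 - T_L x"

definition z :: "nat \<Rightarrow> real" where
  "z n = 1 / real n"

text \<open>\<open>zplus c n\<close> is used for \<open>n \<ge> 2\<close> only, \<open>z n\<close> and \<open>zminus c n\<close> for \<open>n \<ge> 1\<close> only.\<close>

definition zplus :: "real \<Rightarrow> nat \<Rightarrow> real" where
  "zplus c n = z n + c * z n * z (n - 1)"

definition zminus :: "real \<Rightarrow> nat \<Rightarrow> real" where
  "zminus c n = z n - c * z n * z (n + 1)"

text \<open>
  For \<open>c > 0\<close> the two pieces \<open>T_A\<close> and \<open>T_L\<close> of each map exhaust \<open>[c,1]\<close>, so the \<open>T_L\<close> piece
  is the \<open>else\<close> branch.
\<close>

definition T0 :: "real \<Rightarrow> real \<Rightarrow> real" where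
  "T0 c x =
    (if c = 0 then (if x = 0 \<or> x \<in> z ` {1..} then 1 else T_L x)
     else (if x \<in> (\<Union>n\<in>{2..}. {z n..<zplus c n}) then T_A x else T_L x))"

definition T1 :: "real \<Rightarrow> real \<Rightarrow> real" where
  "T1 c x =
    (if c = 0 then (if x = 0 \<or> x \<in> z ` {1..} then 1 else T_A x)
     else (if x \<in> (\<Union>n\<in>{2..}. {z n..zminus c (n - 1)}) then T_A x else T_L x))"

definition T :: "real \<Rightarrow> bit \<Rightarrow> real \<Rightarrow> real" where
  "T c j = (if j = 0 then T0 c else T1 c)"

definition switch_region :: "real \<Rightarrow> real set" where
  "switch_region c =
    (if c = 0 then {0<..1} - z ` {1..}
     else {c..1} \<inter> (\<Union>n\<in>{2..}. {zplus c n..zminus c (n - 1)}))"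

definition shift :: "(nat \<Rightarrow> bit) \<Rightarrow> nat \<Rightarrow> bit" where
  "shift \<omega> = (\<lambda>i. \<omega> (Suc i))"

definition L :: "real \<Rightarrow> (nat \<Rightarrow> bit) \<times> real \<Rightarrow> (nat \<Rightarrow> bit) \<times> real" where
  "L c = (\<lambda>(\<omega>, x). (shift \<omega>, T c (\<omega> 0) x))"

primrec T_iter :: "real \<Rightarrow> (nat \<Rightarrow> bit) \<Rightarrow> nat \<Rightarrow> real \<Rightarrow> real" where
  "T_iter c \<omega> 0 x = x"
| "T_iter c \<omega> (Suc n) x = T c (\<omega> n) (T_iter c \<omega> n x)"

text \<open>
  The final branch of \<open>s1\<close> covers, for \<open>x \<in> [c,1]\<close> with \<open>x \<noteq> 0\<close>, the intervals
  \<open>[z n, zplus c n)\<close>, \<open>n \<ge> 2\<close>, if \<open>c > 0\<close>, and the points \<open>z n\<close>, \<open>n \<ge> 2\<close>, if \<open>c = 0\<close>.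
\<close>

definition s1 :: "real \<Rightarrow> (nat \<Rightarrow> bit) \<times> real \<Rightarrow> bit" where
  "s1 c = (\<lambda>(\<omega>, x).
    if x \<in> switch_region c then \<omega> 0
    else if x = 1 \<or> x \<in> (\<Union>n\<in>{1..}. {zminus c n<..<z n}) then 0
    else 1)"

definition d1 :: "(nat \<Rightarrow> bit) \<times> real \<Rightarrow> nat" where
  "d1 = (\<lambda>(\<omega>, x). if x = 1 then 2 else (THE n. n \<ge> 2 \<and> x \<in> {z n..<z (n - 1)}))"

text \<open>The pair \<open>(s_{i+1}(\<omega>,x), d_{i+1}(\<omega>,x))\<close>.\<close>

definition sign_digit :: "real \<Rightarrow> (nat \<Rightarrow> bit) \<Rightarrow> real \<Rightarrow> nat \<Rightarrow> bit \<times> nat" where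
  "sign_digit c \<omega> x i = (s1 c ((L c ^^ i) (\<omega>, x)), d1 ((L c ^^ i) (\<omega>, x)))"

definition luroth_expansions :: "real \<Rightarrow> real \<Rightarrow> (nat \<Rightarrow> bit \<times> nat) set" where
  "luroth_expansions c x = range (\<lambda>\<omega>. sign_digit c \<omega> x)"

definition ultimately_periodic :: "(nat \<Rightarrow> 'a) \<Rightarrow> bool" where
  "ultimately_periodic a \<longleftrightarrow> (\<exists>n r. r \<ge> 1 \<and> (\<forall>j. a (n + j) = a (n + r + j)))"

definition realises_loop ::
  "real \<Rightarrow> real \<Rightarrow> real \<Rightarrow> bit list \<Rightarrow> (nat \<Rightarrow> bit) \<Rightarrow> nat \<Rightarrow> nat \<Rightarrow> bool" where
  "realises_loop c x y u \<omega> n r \<longleftrightarrow>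
    r \<ge> 1 \<and> map \<omega> [n..<n + r] = u \<and>
    T_iter c \<omega> n x = y \<and> T_iter c \<omega> (n + r) x = y \<and>
    (\<forall>j. 1 \<le> j \<and> j < r \<longrightarrow> T_iter c \<omega> (n + j) x \<noteq> y)"

definition is_loop :: "real \<Rightarrow> real \<Rightarrow> real \<Rightarrow> bit list \<Rightarrow> bool" where
  "is_loop c x y u \<longleftrightarrow> y \<in> {c..1} \<and> (\<exists>\<omega> n r. realises_loop c x y u \<omega> n r)"

text \<open>
  The string of sign-digit pairs along a loop is determined by \<open>y\<close> and \<open>u\<close>, so it does not matter
  which realisations are chosen here.
\<close>

definition loop_equiv :: "real \<Rightarrow> real \<Rightarrow> real \<Rightarrow> bit list \<Rightarrow> bit list \<Rightarrow> bool" where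
  "loop_equiv c x y u1 u2 \<longleftrightarrow>
    (\<exists>\<omega>1 n1 r1 \<omega>2 n2 r2.
      realises_loop c x y u1 \<omega>1 n1 r1 \<and> realises_loop c x y u2 \<omega>2 n2 r2 \<and> r1 = r2 \<and>
      map (sign_digit c \<omega>1 x) [n1..<n1 + r1] = map (sign_digit c \<omega>2 x) [n2..<n2 + r2])"

end

theory Submission
  imports Defs "HOL-Library.Stream"
begin

text \<open>
  The maps do not increase the denominator of a rational point, so the orbit of \<open>x\<close> lives in a finite
  set, and the \<open>c\<close>-Lueroth expansions of \<open>x\<close> are the outputs of a finite transducer in which the
  output at a state determines the next state.  A state visited infinitely often with only one
  return word forces the output to be ultimately periodic.  Two different first-return words form a
  prefix code, because neither can be a proper prefix of the other; hence their infinite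
  concatenations give distinct outputs.  There are uncountably many of these, while only countably
  many sequences over a countable alphabet are ultimately periodic.
\<close>

section \<open>Ultimately periodic sequences\<close>

lemma ultimately_periodicI:
  "r \<ge> 1 \<Longrightarrow> (\<And>j. a (n + j) = a (n + r + j)) \<Longrightarrow> ultimately_periodic a"
  unfolding ultimately_periodic_def by (intro exI conjI allI)

lemma ultimately_periodic_offset:
  assumes "ultimately_periodic (\<lambda>i. a (k + i))"
  shows "ultimately_periodic a"
proof -
  obtain n r where "r \<ge> 1" and eq: "\<And>j. a (k + (n + j)) = a (k + (n + r + j))"
    using assms unfolding ultimately_periodic_def by blast
  have "a (k + n + j) = a (k + n + r + j)" for j
    using eq[of j] by (simp add: add.assoc)
  with \<open>r \<ge> 1\<close> show ?thesis
    by (rule ultimately_periodicI[of r a "k + n"])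
qed

text \<open>A preperiod \<open>n\<close>, a period \<open>r\<close> and the first
  \<open>n + r\<close> letters determine the sequence, and there are only countably many such
  triples.\<close>

lemma countable_ultimately_periodic:
  assumes "countable (UNIV :: 'a set)"
  shows "countable {a :: nat \<Rightarrow> 'a. ultimately_periodic a}"
proof -
  \<comment> \<open>With \<open>r = 0\<close> or too short a list, \<open>g\<close> may read past
    the end of \<open>l\<close>. Such values are harmless: the range of \<open>g\<close> only has to
    be countable and large enough.\<close>
  define g :: "nat \<times> nat \<times> 'a list \<Rightarrow> nat \<Rightarrow> 'a"
    where "g = (\<lambda>(n, r, l) i. if i < n then l ! i else l ! (n + (i - n) mod r))"
  have "countable (lists (UNIV :: 'a set))"
    using assms by (rule countable_lists)
  then have "countable (UNIV :: 'a list set)"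
    by simp
  then have "countable ((UNIV :: nat set) \<times> (UNIV :: nat set) \<times> (UNIV :: 'a list set))"
    by (intro countable_SIGMA) auto
  then have "countable (range g)"
    by (simp add: countable_image)
  moreover have "a \<in> range g" if a: "ultimately_periodic a" for a :: "nat \<Rightarrow> 'a"
  proof -
    obtain n r where r: "r \<ge> 1" and per: "\<And>j. a (n + j) = a (n + r + j)"
      using a unfolding ultimately_periodic_def by blast
    have mult: "a (n + (k * r + j)) = a (n + j)" for k j
    proof (induction k)
      case (Suc k)
      have "a (n + (Suc k * r + j)) = a (n + r + (k * r + j))"
        by (simp add: algebra_simps)
      then show ?case
        using Suc per by simp
    qed simp
    have "a i = g (n, r, map a [0..<n + r]) i" for i
    proof (cases "i < n")
      case False
      have "a i = a (n + ((i - n) div r * r + (i - n) mod r))"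
        using False by (simp del: add.assoc)
      also have "\<dots> = a (n + (i - n) mod r)"
        by (rule mult)
      finally show ?thesis
        using False r by (simp add: g_def)
    qed (simp add: g_def)
    then have "a = g (n, r, map a [0..<n + r])"
      by (rule ext)
    then show ?thesis
      by (rule range_eqI)
  qed
  ultimately show ?thesis
    by (auto intro: countable_subset[rotated])
qed

text \<open>Boolean streams are characteristic functions of sets of naturals, so an enumeration
  would contradict Cantor's theorem.\<close>

lemma uncountable_bool_streams: "uncountable (UNIV :: bool stream set)"
proof
  assume "countable (UNIV :: bool stream set)"
  then have "countable ((\<lambda>s. {n. s !! n}) ` (UNIV :: bool stream set))"
    by (rule countable_image)
  moreover have "A \<in> range (\<lambda>s. {n. s !! n})" for A :: "nat set"
    by (rule range_eqI[of _ _ "smap (\<lambda>n. n \<in> A) nats"]) simp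
  ultimately have "countable (UNIV :: nat set set)"
    by (metis UNIV_eq_I)
  then have "surj (from_nat_into (UNIV :: nat set set))"
    by (simp add: range_from_nat_into)
  then show False
    using Cantors_theorem[of "UNIV :: nat set"] by auto
qed

section \<open>Transducers whose output determines the next state\<close>

text \<open>Intended reading: states are orbit points, inputs the symbols of
  \<open>\<omega>\<close>, outputs the sign-digit pairs. A symbol read outside the switch region
  leaves no mark in the output, so inputs cannot be recovered; \<open>step_eq\<close> is the weaker
  determinism that survives.\<close>

locale transducer =
  fixes step :: "'i \<Rightarrow> 's \<Rightarrow> 's" and out :: "'i \<Rightarrow> 's \<Rightarrow> 'o" and X :: "'s set"
  assumes finite_states: "finite X"
    and step_closed: "q \<in> X \<Longrightarrow> step i q \<in> X"
    and step_eq: "q \<in> X \<Longrightarrow> out i q = out j q \<Longrightarrow> step i q = step j q"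
begin

primrec run :: "(nat \<Rightarrow> 'i) \<Rightarrow> 's \<Rightarrow> nat \<Rightarrow> 's" where
  "run \<omega> q 0 = q"
| "run \<omega> q (Suc n) = step (\<omega> n) (run \<omega> q n)"

definition trace :: "(nat \<Rightarrow> 'i) \<Rightarrow> 's \<Rightarrow> nat \<Rightarrow> 'o" where
  "trace \<omega> q n = out (\<omega> n) (run \<omega> q n)"

text \<open>The loop condition without its input word. Minimality of the return time is what keeps
  one return word from being a proper prefix of another.\<close>

definition returns :: "(nat \<Rightarrow> 'i) \<Rightarrow> 's \<Rightarrow> 's \<Rightarrow> nat \<Rightarrow> nat \<Rightarrow> bool" where
  "returns \<omega> q y n r \<longleftrightarrow> 1 \<le> r \<and> run \<omega> q n = y \<and> run \<omega> q (n + r) = y \<and>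
    (\<forall>j. 1 \<le> j \<and> j < r \<longrightarrow> run \<omega> q (n + j) \<noteq> y)"

definition return_word :: "(nat \<Rightarrow> 'i) \<Rightarrow> 's \<Rightarrow> nat \<Rightarrow> nat \<Rightarrow> 'o list" where
  "return_word \<omega> q n r = map (trace \<omega> q) [n..<n + r]"

lemma run_closed: "q \<in> X \<Longrightarrow> run \<omega> q n \<in> X"
  by (induction n) (auto intro: step_closed)

lemma run_add: "run \<omega> q (m + n) = run (\<lambda>i. \<omega> (m + i)) (run \<omega> q m) n"
  by (induction n) auto

lemma trace_add: "trace \<omega> q (m + n) = trace (\<lambda>i. \<omega> (m + i)) (run \<omega> q m) n"
  by (simp add: trace_def run_add)

lemma run_cong: "(\<And>i. i < n \<Longrightarrow> \<omega> i = \<omega>' i) \<Longrightarrow> run \<omega> q n = run \<omega>' q n"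
  by (induction n) auto

lemma run_eq_if_trace_eq:
  assumes "q \<in> X" and "\<And>i. i < n \<Longrightarrow> trace \<omega> q i = trace \<omega>' q i"
  shows "run \<omega> q n = run \<omega>' q n"
  using assms(2)
proof (induction n)
  case (Suc n)
  then have run: "run \<omega> q n = run \<omega>' q n"
    by simp
  have "out (\<omega> n) (run \<omega> q n) = out (\<omega>' n) (run \<omega> q n)"
    using Suc.prems[of n] by (simp add: trace_def run)
  then have "step (\<omega> n) (run \<omega> q n) = step (\<omega>' n) (run \<omega> q n)"
    by (rule step_eq[OF run_closed[OF \<open>q \<in> X\<close>]])
  then show ?case
    by (simp add: run)
qed simp

text \<open>Independence of the input is known only along the run of \<open>\<omega>\<close>.
  Inductively every other run stays on it, since equal outputs force equal successors.\<close>

lemma trace_unique: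
  assumes "q \<in> X" and indep: "\<And>n i j. out i (run \<omega> q n) = out j (run \<omega> q n)"
  shows "trace \<omega>' q = trace \<omega> q"
proof
  fix n
  have "run \<omega>' q n = run \<omega> q n"
    by (induction n) (use step_eq[OF run_closed[OF \<open>q \<in> X\<close>] indep] in auto)
  then show "trace \<omega>' q n = trace \<omega> q n"
    using indep by (simp add: trace_def)
qed

lemma infinitely_often_visited:
  assumes "q \<in> X"
  shows "\<exists>y\<in>X. \<forall>N. \<exists>n\<ge>N. run \<omega> q n = y"
proof -
  have "range (run \<omega> q) \<subseteq> X"
    by (auto intro: run_closed assms)
  then have "finite (range (run \<omega> q))"
    by (rule finite_subset[OF _ finite_states])
  then obtain n0 where "infinite {n. run \<omega> q n = run \<omega> q n0}"
    using pigeonhole_infinite[of UNIV "run \<omega> q"] by auto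
  then have "\<forall>N. \<exists>n\<ge>N. run \<omega> q n = run \<omega> q n0"
    unfolding infinite_nat_iff_unbounded_le by blast
  then show ?thesis
    by (rule bexI) (rule run_closed[OF assms])
qed

text \<open>A state \<open>y\<close> visited infinitely often cuts the output into first-return
  words. If these coincide, they share one length \<open>r\<close>, and from the visit
  \<open>n0\<close> on the output repeats a single word.\<close>

lemma trace_ultimately_periodic:
  assumes "q \<in> X"
    and unique: "\<And>y n r n' r'. y \<in> X \<Longrightarrow> returns \<omega> q y n r \<Longrightarrow> returns \<omega> q y n' r' \<Longrightarrow>
      return_word \<omega> q n r = return_word \<omega> q n' r'"
  shows "ultimately_periodic (trace \<omega> q)"
proof -
  obtain y where y: "y \<in> X" and often: "\<forall>N. \<exists>n\<ge>N. run \<omega> q n = y"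
    using infinitely_often_visited[OF \<open>q \<in> X\<close>, of \<omega>] by blast
  have next_return: "\<exists>r. returns \<omega> q y n r" if n: "run \<omega> q n = y" for n
  proof -
    define r where "r = (LEAST r. 1 \<le> r \<and> run \<omega> q (n + r) = y)"
    have "\<exists>r. 1 \<le> r \<and> run \<omega> q (n + r) = y"
    proof -
      obtain m where "m \<ge> Suc n" "run \<omega> q m = y"
        using often by blast
      then show ?thesis
        by (intro exI[of _ "m - n"]) auto
    qed
    then have "1 \<le> r \<and> run \<omega> q (n + r) = y"
      unfolding r_def by (rule LeastI_ex)
    moreover have "run \<omega> q (n + j) \<noteq> y" if "1 \<le> j" "j < r" for j
      using that not_less_Least[of j "\<lambda>r. 1 \<le> r \<and> run \<omega> q (n + r) = y"] by (auto simp: r_def)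
    ultimately show ?thesis
      using n by (auto simp: returns_def)
  qed
  obtain n0 where n0: "run \<omega> q n0 = y"
    using often by blast
  obtain r where r: "returns \<omega> q y n0 r"
    using next_return[OF n0] by blast
  have again: "run \<omega> q (n + r) = y \<and> return_word \<omega> q n r = return_word \<omega> q n0 r"
    if n: "run \<omega> q n = y" for n
  proof -
    obtain r' where r': "returns \<omega> q y n r'"
      using next_return[OF n] by blast
    have w: "return_word \<omega> q n r' = return_word \<omega> q n0 r"
      by (rule unique[OF y r' r])
    then have "length (return_word \<omega> q n r') = length (return_word \<omega> q n0 r)"
      by (rule arg_cong)
    then have "r' = r"
      by (simp add: return_word_def)
    then show ?thesis
      using w r' by (simp add: returns_def)
  qed
  have hit: "run \<omega> q (n0 + k * r) = y" for k
  proof (induction k)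
    case (Suc k)
    then have "run \<omega> q (n0 + k * r + r) = y"
      using again by blast
    then show ?case
      by (simp add: algebra_simps)
  qed (simp add: n0)
  have letter: "trace \<omega> q (n0 + k * r + i) = trace \<omega> q (n0 + i)" if "i < r" for k i
  proof -
    have "return_word \<omega> q (n0 + k * r) r ! i = return_word \<omega> q n0 r ! i"
      using again[OF hit] by simp
    then show ?thesis
      using that by (simp add: return_word_def)
  qed
  have "r \<ge> 1"
    using r by (simp add: returns_def)
  have "trace \<omega> q (n0 + j) = trace \<omega> q (n0 + r + j)" for j
  proof -
    have "j mod r < r"
      using \<open>r \<ge> 1\<close> by simp
    \<comment> \<open>Position \<open>j\<close> lies in block number \<open>j div r\<close>; the
      same place in the next block is exactly \<open>r\<close> further on.\<close>
    have "trace \<omega> q (n0 + j div r * r + j mod r) = trace \<omega> q (n0 + Suc (j div r) * r + j mod r)"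
      unfolding letter[OF \<open>j mod r < r\<close>] ..
    moreover have "n0 + j div r * r + j mod r = n0 + j"
      by (simp add: add.assoc)
    moreover have "n0 + Suc (j div r) * r + j mod r = n0 + r + j"
      by (simp add: add.assoc)
    ultimately show ?thesis
      by metis
  qed
  with \<open>r \<ge> 1\<close> show ?thesis
    by (rule ultimately_periodicI[of r "trace \<omega> q" n0])
qed

text \<open>The shortened input reaches \<open>y\<close> at time \<open>m\<close> and continues as
  the original does after time \<open>n\<close>. All inputs yield one trace, so its tails from
  \<open>m\<close> and \<open>n\<close> agree and \<open>r = n - m\<close> is a period.\<close>

lemma trace_ultimately_periodic_if_unique:
  assumes "q \<in> X" and "\<And>\<omega>'. trace \<omega>' q = trace \<omega> q"
  shows "ultimately_periodic (trace \<omega> q)"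
proof -
  obtain y where often: "\<forall>N. \<exists>n\<ge>N. run \<omega> q n = y"
    using infinitely_often_visited[OF \<open>q \<in> X\<close>, of \<omega>] by (elim bexE)
  obtain m where m: "run \<omega> q m = y"
    using often by blast
  obtain n where "n \<ge> Suc m" and n: "run \<omega> q n = y"
    using spec[OF often, of "Suc m"] by blast
  define r where "r = n - m"
  then have r: "n = m + r" "r \<ge> 1"
    using \<open>n \<ge> Suc m\<close> by simp_all
  \<comment> \<open>Cut out the cycle between the times \<open>m\<close> and \<open>n\<close>.\<close>
  define \<omega>' where "\<omega>' = (\<lambda>i. if i < m then \<omega> i else \<omega> (i + r))"
  have "run \<omega>' q m = run \<omega> q m"
    by (rule run_cong) (simp add: \<omega>'_def)
  moreover have "(\<lambda>i. \<omega>' (m + i)) = (\<lambda>i. \<omega> (n + i))"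
    unfolding \<omega>'_def r(1) by (rule ext) (simp add: add.assoc add.commute[of r])
  ultimately have "trace \<omega>' q (m + j) = trace \<omega> q (n + j)" for j
    using trace_add[of \<omega>' q m j] trace_add[of \<omega> q n j] m n by argo
  then have "trace \<omega> q (m + j) = trace \<omega> q (m + r + j)" for j
    unfolding assms(2)[of \<omega>'] r(1)[symmetric] .
  with r(2) show ?thesis
    by (rule ultimately_periodicI[of r "trace \<omega> q" m])
qed

section \<open>Replaying a finite stretch of input from the state where it began\<close>

definition input_word :: "(nat \<Rightarrow> 'i) \<Rightarrow> nat \<Rightarrow> nat \<Rightarrow> 'i list" where
  "input_word \<omega> n r = map \<omega> [n..<n + r]"

lemma length_input_word [simp]: "length (input_word \<omega> n r) = r"
  by (simp add: input_word_def)

lemma input_word_nth [simp]: "i < r \<Longrightarrow> input_word \<omega> n r ! i = \<omega> (n + i)"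
  by (simp add: input_word_def)

text \<open>The tail \<open>s\<close> is arbitrary, as the first \<open>i\<close> steps do not read
  it. The case \<open>i = r\<close> is included because the return to \<open>y\<close> is seen after
  the last letter.\<close>

lemma run_input_word:
  assumes "run \<omega> q n = y" and "i \<le> r"
  shows "run (snth (input_word \<omega> n r @- s)) y i = run \<omega> q (n + i)"
proof -
  have "run (snth (input_word \<omega> n r @- s)) y i = run (\<lambda>i. \<omega> (n + i)) y i"
    by (rule run_cong) (use assms in simp)
  then show ?thesis
    using assms by (simp add: run_add)
qed

lemma trace_input_word:
  assumes "run \<omega> q n = y" and "i < r"
  shows "trace (snth (input_word \<omega> n r @- s)) y i = trace \<omega> q (n + i)"
  using assms by (simp add: trace_def run_input_word)

lemma trace_shift:
  "trace (snth (u @- s)) q (length u + i) = trace (snth s) (run (snth (u @- s)) q (length u)) i"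
  unfolding trace_add by (simp add: shift_snth_ge)

text \<open>Both words arise by replaying one input word from \<open>y\<close>. Hence the output
  string of a loop does not depend on its realisation.\<close>

lemma return_word_cong:
  assumes "run \<omega> q n = y" and "run \<omega>' q n' = y" and "input_word \<omega> n r = input_word \<omega>' n' r'"
  shows "return_word \<omega> q n r = return_word \<omega>' q n' r'"
proof -
  have "r = r'"
    using arg_cong[OF assms(3), of length] by simp
  moreover have "trace \<omega> q (n + i) = trace \<omega>' q (n' + i)" if "i < r" for i
    using that trace_input_word[OF assms(1)] trace_input_word[OF assms(2)] assms(3) \<open>r = r'\<close>
    by metis
  ultimately show ?thesis
    by (intro nth_equalityI) (simp_all add: return_word_def)
qed

end

section \<open>Free concatenation of two distinct first-return words\<close>

locale two_returns = transducer step out X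
  for step :: "'i \<Rightarrow> 's \<Rightarrow> 's" and out :: "'i \<Rightarrow> 's \<Rightarrow> 'o" and X +
  fixes q y \<omega>1 n1 r1 \<omega>2 n2 r2
  assumes start: "q \<in> X"
    and ret1: "returns \<omega>1 q y n1 r1"
    and ret2: "returns \<omega>2 q y n2 r2"
    and words_neq: "return_word \<omega>1 q n1 r1 \<noteq> return_word \<omega>2 q n2 r2"
begin

lemma return_at1: "run \<omega>1 q n1 = y" and return_at2: "run \<omega>2 q n2 = y"
  using ret1 ret2 by (simp_all add: returns_def)

definition block :: "bool \<Rightarrow> 'i list" where
  "block b = (if b then input_word \<omega>1 n1 r1 else input_word \<omega>2 n2 r2)"

definition code :: "bool stream \<Rightarrow> 'i stream" where
  "code s = flat (smap block s)"

lemma y_in: "y \<in> X"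
  using run_closed[OF start, of \<omega>1 n1] ret1 by (simp add: returns_def)

text \<open>\<open>flat\<close> unfolds over nonempty blocks; both blocks are nonempty since return
  times are at least 1.\<close>

lemma code_unfold: "code (b ## s) = block b @- code s"
proof -
  have "block b \<noteq> []"
    using ret1 ret2 length_input_word[of \<omega>1 n1 r1] length_input_word[of \<omega>2 n2 r2]
    by (auto simp: block_def returns_def simp del: length_input_word)
  then show ?thesis
    by (simp add: code_def flat_unfold)
qed

lemma run_block: "run (snth (block b @- s)) y (length (block b)) = y"
  using ret1 ret2
  by (simp add: block_def run_input_word[OF return_at1] run_input_word[OF return_at2] returns_def)

lemma trace_block: "trace (snth (block b @- s)) y (length (block b) + i) = trace (snth s) y i"
  by (simp add: trace_shift run_block)

text \<open>The prefix-code property. Equal traces give equal states, so with unequal return times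
  the longer first return would meet \<open>y\<close> too early. With equal times the return words
  would agree, against \<open>words_neq\<close>.\<close>

lemma blocks_distinguishable:
  "trace (snth (block True @- s)) y \<noteq> trace (snth (block False @- s')) y"
proof
  let ?\<omega> = "snth (block True @- s)" and ?\<omega>' = "snth (block False @- s')"
  assume eq: "trace ?\<omega> y = trace ?\<omega>' y"
  then have run_eq: "run ?\<omega> y i = run ?\<omega>' y i" for i
    by (intro run_eq_if_trace_eq[OF y_in]) simp
  have run1: "run ?\<omega> y i = run \<omega>1 q (n1 + i)" if "i \<le> r1" for i
    using that by (simp add: block_def run_input_word[OF return_at1])
  have run2: "run ?\<omega>' y i = run \<omega>2 q (n2 + i)" if "i \<le> r2" for i
    using that by (simp add: block_def run_input_word[OF return_at2])
  have "\<not> r1 < r2"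
    using ret1 ret2 run_eq[of r1] run1[of r1] run2[of r1] by (auto simp: returns_def)
  moreover have "\<not> r2 < r1"
    using ret1 ret2 run_eq[of r2] run1[of r2] run2[of r2] by (auto simp: returns_def)
  ultimately have "r1 = r2"
    by simp
  moreover have "trace \<omega>1 q (n1 + i) = trace \<omega>2 q (n2 + i)" if "i < r1" "i < r2" for i
    using that fun_cong[OF eq, of i]
    by (simp add: block_def trace_input_word[OF return_at1] trace_input_word[OF return_at2])
  ultimately have "return_word \<omega>1 q n1 r1 = return_word \<omega>2 q n2 r2"
    by (intro nth_equalityI) (simp_all add: return_word_def)
  with words_neq show False ..
qed

text \<open>Decoding: the trace reveals the first block, and dropping that block leaves the trace of
  the remaining stream, again started in \<open>y\<close>.\<close>

lemma inj_code_trace: "inj (\<lambda>s. trace (snth (code s)) y)"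
proof (rule injI)
  fix s s' assume "trace (snth (code s)) y = trace (snth (code s')) y"
  then have nth: "s !! k = s' !! k" for k
  proof (induction k arbitrary: s s')
    case (0 s s')
    obtain b t b' t' where s: "s = b ## t" and s': "s' = b' ## t'"
      by (metis stream.exhaust)
    show ?case
      using 0 blocks_distinguishable[of "code t" "code t'"] blocks_distinguishable[of "code t'" "code t"]
      by (cases b; cases b') (simp_all add: s s' code_unfold)
  next
    case (Suc k s s')
    obtain b t b' t' where s: "s = b ## t" and s': "s' = b' ## t'"
      by (metis stream.exhaust)
    have "b = b'"
      using Suc.prems blocks_distinguishable[of "code t" "code t'"]
        blocks_distinguishable[of "code t'" "code t"]
      by (cases b; cases b') (simp_all add: s s' code_unfold)
    have "trace (snth (code t)) y i = trace (snth (code t')) y i" for i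
      using fun_cong[OF Suc.prems, of "length (block b) + i"]
      by (simp add: s s' code_unfold trace_block \<open>b = b'\<close>)
    then show ?case
      using Suc.IH[of t t'] by (auto simp: s s')
  qed
  have "smap (snth s) nats = smap (snth s') nats"
    by (rule stream.map_cong0) (rule nth)
  then show "s = s'"
    by (simp only: stream_smap_nats[symmetric])
qed

text \<open>The first \<open>n1\<close> inputs of \<open>\<omega>1\<close> steer from
  \<open>q\<close> to \<open>y\<close>, where blocks can be concatenated freely.\<close>

definition prefixed :: "bool stream \<Rightarrow> nat \<Rightarrow> 'i" where
  "prefixed s = snth (map \<omega>1 [0..<n1] @- code s)"

lemma trace_prefixed: "trace (prefixed s) q (n1 + i) = trace (snth (code s)) y i"
proof -
  have "run (prefixed s) q n1 = run \<omega>1 q n1"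
    by (rule run_cong) (simp add: prefixed_def)
  then have "run (prefixed s) q n1 = y"
    using ret1 by (simp add: returns_def)
  then show ?thesis
    using trace_shift[of "map \<omega>1 [0..<n1]" "code s" q i] by (simp add: prefixed_def)
qed

lemma inj_prefixed_trace: "inj (\<lambda>s. trace (prefixed s) q)"
proof (rule injI)
  fix s s' assume eq: "trace (prefixed s) q = trace (prefixed s') q"
  have "trace (snth (code s)) y = trace (snth (code s')) y"
    using fun_cong[OF eq, of "n1 + _"] by (auto simp: trace_prefixed)
  then show "s = s'"
    by (rule injD[OF inj_code_trace])
qed

lemma uncountable_traces: "uncountable (range (\<lambda>\<omega>. trace \<omega> q))"
proof
  assume "countable (range (\<lambda>\<omega>. trace \<omega> q))"
  then have "countable (range (\<lambda>s. trace (prefixed s) q))"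
    by (rule countable_subset[rotated]) blast
  then have "countable (UNIV :: bool stream set)"
    by (rule countable_image_inj_on[OF _ inj_prefixed_trace])
  then show False
    using uncountable_bool_streams by simp
qed

text \<open>The constant tail repeats one return and has \<open>length (block False)\<close> as a
  period; the \<open>k\<close> leading blocks are a preperiod, stripped one at a time.\<close>

lemma code_trace_ultimately_periodic:
  "ultimately_periodic (trace (snth (code (replicate k True @- sconst False))) y)"
proof (induction k)
  case 0
  have "sconst False = False ## sconst False"
    by (subst siterate.code) simp
  then have "code (sconst False) = block False @- code (sconst False)"
    using code_unfold by (rule trans[OF arg_cong])
  then have "trace (snth (code (sconst False))) y j
    = trace (snth (code (sconst False))) y (length (block False) + j)" for j
    using trace_block[of False "code (sconst False)" j] by argo
  moreover have "length (block False) \<ge> 1"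
    using ret2 by (simp add: block_def returns_def)
  ultimately show ?case
    by (intro ultimately_periodicI[where n = 0 and r = "length (block False)"])
      (simp_all only: add_0 replicate_0 shift.simps)
next
  case (Suc k)
  show ?case
    by (rule ultimately_periodic_offset[where k = "length (block True)"])
      (simp only: replicate_Suc shift.simps code_unfold trace_block Suc)
qed

lemma infinite_ultimately_periodic_traces:
  "infinite {e \<in> range (\<lambda>\<omega>. trace \<omega> q). ultimately_periodic e}"
proof -
  define s where "s k = replicate k True @- sconst False" for k
  have "inj s"
  proof (rule linorder_injI)
    fix k k' :: nat assume "k < k'"
    \<comment> \<open>Position \<open>k\<close> is the first \<open>False\<close> of
      \<open>s k\<close> but still inside the initial \<open>True\<close> run of
      \<open>s k'\<close>.\<close>
    then have "\<not> s k !! k" "s k' !! k"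
      by (simp_all add: s_def shift_snth)
    then show "s k \<noteq> s k'"
      by auto
  qed
  then have "inj (\<lambda>k. trace (prefixed (s k)) q)"
    using inj_compose[OF inj_prefixed_trace] by (simp add: comp_def)
  then have "infinite (range (\<lambda>k. trace (prefixed (s k)) q))"
    by (rule range_inj_infinite)
  moreover have "ultimately_periodic (trace (prefixed (s k)) q)" for k
    by (rule ultimately_periodic_offset[where k = n1])
      (simp add: trace_prefixed s_def code_trace_ultimately_periodic)
  then have "range (\<lambda>k. trace (prefixed (s k)) q)
      \<subseteq> {e \<in> range (\<lambda>\<omega>. trace \<omega> q). ultimately_periodic e}"
    by blast
  ultimately show ?thesis
    by (metis infinite_super)
qed

end

section \<open>The Lueroth maps\<close>

lemma z_step:
  assumes "n \<ge> 2"
  shows "z n * z (n - 1) = z (n - 1) - z n" and "0 < z n * z (n - 1)" and "z (n - 1) \<le> 1" and "0 < z n"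
proof -
  have n: "real n = real (n - 1) + 1" "real (n - 1) \<ge> 1"
    using assms by (auto simp: of_nat_diff)
  define p where "p = real (n - 1)"
  have p: "real n = p + 1" "p \<ge> 1"
    using n by (simp_all add: p_def)
  then show "z n * z (n - 1) = z (n - 1) - z n"
    unfolding z_def p_def[symmetric] p(1) by (simp add: field_simps)
  show "0 < z n * z (n - 1)" "z (n - 1) \<le> 1" "0 < z n"
    using p unfolding z_def p_def[symmetric] p(1) by simp_all
qed

text \<open>The ceiling of \<open>1 / y\<close> equals \<open>n\<close> throughout the cell, so
  \<open>T_L\<close> is the increasing affine map of the cell onto \<open>[0,1)\<close>.\<close>

lemma T_L_cell:
  assumes "n \<ge> 2" and "z n \<le> y" and "y < z (n - 1)"
  shows "T_L y = (y - z n) / (z n * z (n - 1))"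
proof -
  have n: "real (n - 1) = real n - 1" "real n - 1 > 0" "real n > 0"
    using assms(1) by (auto simp: of_nat_diff)
  have y: "0 < y" "y < 1"
    using assms z_step(3,4)[OF assms(1)] by linarith+
  have "1 / y \<le> real n" "real n - 1 < 1 / y"
    using assms(2,3) n y by (simp_all add: z_def field_simps)
  then have "\<lceil>1 / y\<rceil> = int n"
    by (intro ceiling_unique) simp_all
  then have "T_L y = real n * (real n - 1) * y - (real n - 1)"
    using y by (simp add: T_L_def)
  also have "\<dots> = (y - z n) / (z n * z (n - 1))"
    using n by (simp add: z_def right_diff_distrib left_diff_distrib)
  finally show ?thesis .
qed

text \<open>\<open>zplus c n\<close> is the point where the increasing formula of
  \<open>T_L_cell\<close> takes the value \<open>c\<close>; likewise \<open>zminus c (n - 1)\<close>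
  belongs to the value \<open>1 - c\<close>.\<close>

lemma zplus_le_iff:
  assumes "n \<ge> 2" and "z n \<le> y" and "y < z (n - 1)"
  shows "zplus c n \<le> y \<longleftrightarrow> c \<le> T_L y"
proof -
  have "c \<le> T_L y \<longleftrightarrow> c * (z n * z (n - 1)) \<le> y - z n"
    using z_step(2)[OF assms(1)] by (simp only: T_L_cell[OF assms] pos_le_divide_eq)
  then show ?thesis
    by (simp add: zplus_def mult.assoc) linarith
qed

lemma zminus_pred: "n \<ge> 2 \<Longrightarrow> zminus c (n - 1) = z (n - 1) - c * (z n * z (n - 1))"
  by (simp add: zminus_def)

lemma le_zminus_iff:
  assumes "n \<ge> 2" and "z n \<le> y" and "y < z (n - 1)"
  shows "y \<le> zminus c (n - 1) \<longleftrightarrow> T_L y \<le> 1 - c"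
proof -
  have "T_L y \<le> 1 - c \<longleftrightarrow> y - z n \<le> (1 - c) * (z n * z (n - 1))"
    using z_step(2)[OF assms(1)] by (simp only: T_L_cell[OF assms] pos_divide_le_eq)
  then show ?thesis
    using z_step(1)[OF assms(1)] unfolding zminus_pred[OF assms(1)]
    by (simp only: left_diff_distrib mult_1) linarith
qed

text \<open>The two points belong to the values \<open>c\<close> and \<open>1 - c\<close> of an
  increasing branch, so their order is that of \<open>c\<close> and \<open>1 - c\<close>.\<close>

lemma zplus_le_zminus:
  assumes "n \<ge> 2" and "c \<le> 1 / 2"
  shows "zplus c n \<le> zminus c (n - 1)"
proof -
  have "c * (z n * z (n - 1)) \<le> 1 / 2 * (z n * z (n - 1))"
    using assms z_step(2)[OF assms(1)] by (intro mult_right_mono) simp_all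
  then show ?thesis
    using z_step(1)[OF assms(1)] unfolding zminus_pred[OF assms(1)] zplus_def mult.assoc
    by linarith
qed

lemma zminus_less:
  assumes "n \<ge> 2" and "0 < c"
  shows "zminus c (n - 1) < z (n - 1)"
  using z_step(2)[OF assms(1)] assms(2) unfolding zminus_pred[OF assms(1)] by simp

lemma cell_exists:
  assumes "0 < y" and "y < 1"
  obtains n where "n \<ge> 2" "z n \<le> y" "y < z (n - 1)"
proof
  define n where "n = nat \<lceil>1 / y\<rceil>"
  have "1 / y > 1"
    using assms by simp
  then have ceil: "\<lceil>1 / y\<rceil> > 1"
    by simp
  then show "nat \<lceil>1 / y\<rceil> \<ge> 2"
    by linarith
  have "real n = of_int \<lceil>1 / y\<rceil>" "real (n - 1) = of_int \<lceil>1 / y\<rceil> - 1" "real n > 1" "real (n - 1) > 0"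
    using ceil unfolding n_def by linarith+
  moreover have "1 / y \<le> of_int \<lceil>1 / y\<rceil>" "of_int \<lceil>1 / y\<rceil> - 1 < 1 / y"
    by linarith+
  ultimately have "1 / y \<le> real n" "real (n - 1) < 1 / y" "real n > 1" "real (n - 1) > 0"
    by linarith+
  then show "z (nat \<lceil>1 / y\<rceil>) \<le> y" "y < z (nat \<lceil>1 / y\<rceil> - 1)"
    using assms by (auto simp: z_def n_def[symmetric] field_simps)
qed

lemma T_L_unit:
  assumes "0 < y" and "y < 1"
  shows "0 \<le> T_L y" and "T_L y < 1"
proof -
  obtain n where n: "n \<ge> 2" "z n \<le> y" "y < z (n - 1)"
    using cell_exists[OF assms] .
  show "0 \<le> T_L y"
    using zplus_le_iff[OF n, of 0] n by (simp add: zplus_def)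
  show "T_L y < 1"
    using n(3) z_step(1,2)[OF n(1)] by (simp add: T_L_cell[OF n])
qed

lemma cell_lt_1: "n \<ge> 2 \<Longrightarrow> y < z (n - 1) \<Longrightarrow> y < 1"
  using z_step(3)[of n] by linarith

section \<open>Invariance of the interval, and agreement of the two maps off the switch
  region\<close>

lemma T0_eq_T_A: "0 < c \<Longrightarrow> y \<in> (\<Union>n\<in>{2..}. {z n..<zplus c n}) \<Longrightarrow> T0 c y = T_A y"
  unfolding T0_def by (metis less_irrefl)

lemma T0_eq_T_L: "0 < c \<Longrightarrow> y \<notin> (\<Union>n\<in>{2..}. {z n..<zplus c n}) \<Longrightarrow> T0 c y = T_L y"
  unfolding T0_def by (metis less_irrefl)

lemma T1_eq_T_A: "0 < c \<Longrightarrow> y \<in> (\<Union>n\<in>{2..}. {z n..zminus c (n - 1)}) \<Longrightarrow> T1 c y = T_A y"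
  unfolding T1_def by (metis less_irrefl)

lemma T1_eq_T_L: "0 < c \<Longrightarrow> y \<notin> (\<Union>n\<in>{2..}. {z n..zminus c (n - 1)}) \<Longrightarrow> T1 c y = T_L y"
  unfolding T1_def by (metis less_irrefl)

text \<open>\<open>T0\<close> applies \<open>T_A\<close> where \<open>T_L < c\<close>, giving a
  value above \<open>1 - c \<ge> c\<close>; in the other cell points \<open>T_L\<close> is at least
  \<open>c\<close>. \<open>T1\<close> applies \<open>T_A\<close> where
  \<open>T_L \<le> 1 - c\<close>, giving at least \<open>c\<close>; in the other cell points
  \<open>T_L\<close> exceeds \<open>1 - c \<ge> c\<close>. The point 1 lies in no cell and is
  fixed.\<close>

lemma T_mem_Icc:
  assumes c: "0 < c" "c \<le> 1 / 2" and y: "y \<in> {c..1}"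
  shows "T c j y \<in> {c..1}"
proof -
  have "T0 c y \<in> {c..1}"
  proof (cases "y \<in> (\<Union>n\<in>{2..}. {z n..<zplus c n})")
    case True
    then obtain n where n: "n \<ge> 2" "z n \<le> y" "y < zplus c n"
      by auto
    then have cell: "y < z (n - 1)"
      using zplus_le_zminus[OF n(1) c(2)] zminus_less[OF n(1) c(1)] by linarith
    have "T_L y < c" "0 \<le> T_L y"
      using zplus_le_iff[OF n(1,2) cell, of c] n(3) T_L_unit(1)[of y] y c cell_lt_1[OF n(1) cell]
      by auto
    moreover have "T0 c y = 1 - T_L y"
      using True c T0_eq_T_A[of c y] by (simp only: T_A_def)
    ultimately show ?thesis
      using c by simp
  next
    case False
    then have T0: "T0 c y = T_L y"
      using c T0_eq_T_L[of c y] by blast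
    show ?thesis
    proof (cases "y = 1")
      case True
      then show ?thesis
        using c T0 by (simp add: T_L_def)
    next
      case neq: False
      then have "0 < y" "y < 1"
        using y c by auto
      then obtain n where n: "n \<ge> 2" "z n \<le> y" "y < z (n - 1)"
        using cell_exists by blast
      then have "zplus c n \<le> y"
        using False by force
      then show ?thesis
        using zplus_le_iff[OF n] T0 T_L_unit(2)[OF \<open>0 < y\<close> \<open>y < 1\<close>] by simp
    qed
  qed
  moreover have "T1 c y \<in> {c..1}"
  proof (cases "y \<in> (\<Union>n\<in>{2..}. {z n..zminus c (n - 1)})")
    case True
    then obtain n where n: "n \<ge> 2" "z n \<le> y" "y \<le> zminus c (n - 1)"
      by auto
    then have cell: "y < z (n - 1)"
      using zminus_less[OF n(1) c(1)] by linarith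
    have "T_L y \<le> 1 - c" "0 \<le> T_L y"
      using le_zminus_iff[OF n(1,2) cell, of c] n(3) T_L_unit(1)[of y] y c cell_lt_1[OF n(1) cell]
      by auto
    moreover have "T1 c y = 1 - T_L y"
      using True c T1_eq_T_A[of c y] by (simp only: T_A_def)
    ultimately show ?thesis
      using c by simp
  next
    case False
    then have T1: "T1 c y = T_L y"
      using c T1_eq_T_L[of c y] by blast
    show ?thesis
    proof (cases "y = 1")
      case True
      then show ?thesis
        using c T1 by (simp add: T_L_def)
    next
      case neq: False
      then have "0 < y" "y < 1"
        using y c by auto
      then obtain n where n: "n \<ge> 2" "z n \<le> y" "y < z (n - 1)"
        using cell_exists by blast
      then have "\<not> y \<le> zminus c (n - 1)"
        using False by force
      then show ?thesis
        using le_zminus_iff[OF n, of c] T1 T_L_unit(2)[OF \<open>0 < y\<close> \<open>y < 1\<close>] c by simp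
    qed
  qed
  ultimately show ?thesis
    by (simp add: T_def)
qed

text \<open>On a cell \<open>T_L\<close> vanishes only at the left endpoint, and at every
  \<open>z n\<close> both maps are set to 1. Elsewhere \<open>T_L\<close> lies strictly between 0
  and 1, hence so does \<open>T_A\<close>.\<close>

lemma T_mem_Icc_0:
  assumes "y \<in> {0<..1}"
  shows "T 0 j y \<in> {0<..1}"
proof (cases "y \<in> z ` {1..}")
  case True
  then show ?thesis
    by (simp add: T_def T0_def T1_def)
next
  case False
  have "y \<noteq> 1"
  proof
    assume "y = 1"
    then have "y = z 1"
      by (simp add: z_def)
    then show False
      using False by auto
  qed
  then have y: "0 < y" "y < 1"
    using assms by auto
  then obtain n where n: "n \<ge> 2" "z n \<le> y" "y < z (n - 1)"
    using cell_exists by blast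
  have "y \<noteq> z n"
    using False n(1) by auto
  then have "z n < y"
    using n(2) by simp
  then have "0 < T_L y"
    using z_step(2)[OF n(1)] by (simp add: T_L_cell[OF n])
  then show ?thesis
    using T_L_unit(2)[OF y] y False by (auto simp: T_def T0_def T1_def T_A_def)
qed

lemma T_mem:
  assumes "c \<in> {0..1/2}" and "y \<in> {c..1}" and "y \<noteq> 0"
  shows "T c j y \<in> {c..1} - {0}"
proof (cases "c = 0")
  case True
  then show ?thesis
    using T_mem_Icc_0[of y j] assms by auto
next
  case False
  then show ?thesis
    using T_mem_Icc[of c y j] assms by auto
qed

text \<open>For \<open>c > 0\<close> the \<open>T_A\<close> pieces \<open>[z n, zplus c n)\<close>
  and \<open>[z n, zminus c (n - 1)]\<close> differ only by points of the switch region. For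
  \<open>c = 0\<close> a nonzero point outside it is some \<open>z n\<close>, where both maps give
  1.\<close>

lemma T_eq_outside_switch_region:
  assumes c: "c \<in> {0..1/2}" and y: "y \<in> {c..1}" "y \<noteq> 0" "y \<notin> switch_region c"
  shows "T c i y = T c j y"
proof -
  have "T0 c y = T1 c y"
  proof (cases "c = 0")
    case True
    then show ?thesis
      using y by (auto simp: T0_def T1_def switch_region_def)
  next
    case False
    have "y \<in> (\<Union>n\<in>{2..}. {z n..<zplus c n}) \<longleftrightarrow> y \<in> (\<Union>n\<in>{2..}. {z n..zminus c (n - 1)})"
    proof
      assume "y \<in> (\<Union>n\<in>{2..}. {z n..<zplus c n})"
      then obtain n where "n \<ge> 2" "z n \<le> y" "y < zplus c n"
        by auto
      then show "y \<in> (\<Union>n\<in>{2..}. {z n..zminus c (n - 1)})"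
        using zplus_le_zminus[of n c] c by force
    next
      assume "y \<in> (\<Union>n\<in>{2..}. {z n..zminus c (n - 1)})"
      then obtain n where "n \<ge> 2" "z n \<le> y" "y \<le> zminus c (n - 1)"
        by auto
      moreover from this have "y < zplus c n"
        using y False by (force simp: switch_region_def)
      ultimately show "y \<in> (\<Union>n\<in>{2..}. {z n..<zplus c n})"
        by force
    qed
    then show ?thesis
      using False by (simp add: T0_def T1_def)
  qed
  then show ?thesis
    by (simp add: T_def)
qed

text \<open>Apart from the values 0 and 1, \<open>T_L y\<close> is affine in \<open>y\<close> with
  integer coefficients once the ceiling is named \<open>m\<close>, so the denominator
  \<open>b\<close> is kept. Fractions need not be in lowest terms.\<close>

lemma T_denominator:
  fixes b k :: int
  assumes "b \<noteq> 0" and "y = of_int k / of_int b"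
  shows "\<exists>l::int. T c j y = of_int l / of_int b"
proof -
  have one: "\<exists>l::int. 1 = (of_int l / of_int b :: real)"
    using assms(1) by (intro exI[of _ b]) simp
  have TL: "\<exists>l::int. T_L y = of_int l / of_int b"
  proof (cases "y = 0 \<or> y = 1")
    case True
    then show ?thesis
      using one by (auto simp: T_L_def)
  next
    case False
    define m where "m = \<lceil>1 / y\<rceil>"
    have "T_L y = of_int m * (of_int m - 1) * (of_int k / of_int b) - (of_int m - 1)"
      using False unfolding assms(2)[symmetric] T_L_def m_def[symmetric]
      by (simp only: de_Morgan_disj if_False)
    also have "\<dots> = of_int (m * (m - 1) * k - (m - 1) * b) / of_int b"
      using assms(1) by (simp add: diff_divide_distrib)
    finally have "T_L y = of_int (m * (m - 1) * k - (m - 1) * b) / of_int b" .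
    then show ?thesis ..
  qed
  then obtain l :: int where l: "T_L y = of_int l / of_int b" ..
  have TA: "\<exists>l::int. T_A y = of_int l / of_int b"
    using assms(1) l by (intro exI[of _ "b - l"]) (simp add: T_A_def field_simps)
  show ?thesis
    using one TL TA by (auto simp: T_def T0_def T1_def)
qed

section \<open>Expansions of a rational point as outputs of a finite transducer\<close>

definition sign_digit_at :: "real \<Rightarrow> bit \<Rightarrow> real \<Rightarrow> bit \<times> nat" where
  "sign_digit_at c j y = (s1 c (\<lambda>_. j, y), d1 (\<lambda>_. j, y))"

lemma sign_digit_at_eq_outside_switch_region:
  "y \<notin> switch_region c \<Longrightarrow> sign_digit_at c i y = sign_digit_at c j y"
  by (simp add: sign_digit_at_def s1_def d1_def)

text \<open>Inside the switch region the sign is the input symbol itself.\<close>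

lemma sign_digit_at_eqD: "y \<in> switch_region c \<Longrightarrow> sign_digit_at c i y = sign_digit_at c j y \<Longrightarrow> i = j"
  by (simp add: sign_digit_at_def s1_def)

lemma L_funpow: "(L c ^^ i) (\<omega>, x) = (\<lambda>j. \<omega> (i + j), T_iter c \<omega> i x)"
  by (induction i) (simp_all add: L_def Defs.shift_def)

text \<open>\<open>s1\<close> and \<open>d1\<close> look at no symbol beyond the first, so the
  constant sequence in \<open>sign_digit_at\<close> can replace the shifted
  \<open>\<omega>\<close>.\<close>

lemma sign_digit_eq: "sign_digit c \<omega> x i = sign_digit_at c (\<omega> i) (T_iter c \<omega> i x)"
  unfolding sign_digit_def L_funpow by (simp add: sign_digit_at_def s1_def d1_def)

theorem proposition2p5:
  fixes c x :: real
  assumes "c \<in> {0..1/2}" and "x \<in> \<rat> \<inter> {c..1}" and "x \<noteq> 0"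
  shows
    "((\<exists>\<omega>. \<forall>n. T_iter c \<omega> n x \<notin> switch_region c) \<longrightarrow>
        (\<exists>e. luroth_expansions c x = {e} \<and> ultimately_periodic e)) \<and>
     ((\<forall>y\<in>{c..1}. \<forall>u1 u2. is_loop c x y u1 \<and> is_loop c x y u2 \<longrightarrow> loop_equiv c x y u1 u2) \<longrightarrow>
        (\<forall>e\<in>luroth_expansions c x. ultimately_periodic e) \<and>
        countable (luroth_expansions c x)) \<and>
     ((\<exists>y\<in>{c..1}. \<exists>u1 u2. is_loop c x y u1 \<and> is_loop c x y u2 \<and> \<not> loop_equiv c x y u1 u2) \<longrightarrow>
        uncountable {e \<in> luroth_expansions c x. \<not> ultimately_periodic e} \<and>
        countable {e \<in> luroth_expansions c x. ultimately_periodic e} \<and>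
        infinite {e \<in> luroth_expansions c x. ultimately_periodic e})"
proof -
  have c: "c \<in> {0..1/2}" and x: "x \<in> {c..1}" "x \<noteq> 0"
    using assms by auto
  obtain a b :: int where b: "b > 0" and ab: "x = of_int a / of_int b"
    using assms(2) by (auto elim: Rats_cases')
  \<comment> \<open>The state set: points with denominator \<open>b\<close>. The point 0, in
    \<open>[c,1]\<close> only if \<open>c = 0\<close>, has no digit and is excluded;
    \<open>T_mem\<close> keeps orbits away from it.\<close>
  define X where "X = {y \<in> {c..1} - {0}. \<exists>k::int. y = of_int k / of_int b}"
  have "X \<subseteq> (\<lambda>k. of_int k / of_int b) ` {0..b}"
  proof
    fix y assume "y \<in> X"
    then obtain k :: int where k: "y = of_int k / of_int b" and "0 \<le> y" "y \<le> 1"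
      using c by (auto simp: X_def)
    then have "0 \<le> real_of_int k" "real_of_int k \<le> real_of_int b"
      using b by (simp_all add: divide_le_eq zero_le_divide_iff)
    then have "k \<in> {0..b}"
      by simp
    with k show "y \<in> (\<lambda>k. of_int k / of_int b) ` {0..b}"
      by blast
  qed
  then have "finite X"
    by (rule finite_subset) simp
  have "x \<in> X"
    using x ab by (auto simp: X_def)
  interpret transducer "T c" "sign_digit_at c" X
  proof
    show "finite X" by fact
    show "T c i y \<in> X" if "y \<in> X" for i y
      using that T_mem[OF c, of y i] T_denominator[of b y _ c i] b by (auto simp: X_def)
    \<comment> \<open>In the switch region equal outputs mean equal symbols; outside it the symbol
      does not influence the map.\<close>
    show "T c i y = T c j y" if "y \<in> X" "sign_digit_at c i y = sign_digit_at c j y" for i j y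
    proof (cases "y \<in> switch_region c")
      case True
      then show ?thesis
        using sign_digit_at_eqD that(2) by metis
    next
      case False
      then show ?thesis
        using T_eq_outside_switch_region[OF c] that(1) by (auto simp: X_def)
    qed
  qed
  have run: "T_iter c \<omega> n x = run \<omega> x n" for \<omega> n
    by (induction n) simp_all
  have trace: "sign_digit c \<omega> x = trace \<omega> x" for \<omega>
    by (rule ext) (simp add: sign_digit_eq trace_def run)
  have expansions: "luroth_expansions c x = range (\<lambda>\<omega>. trace \<omega> x)"
    by (simp add: luroth_expansions_def trace)
  have realises: "realises_loop c x y u \<omega> n r \<longleftrightarrow> returns \<omega> x y n r \<and> u = input_word \<omega> n r"
    for y u \<omega> n r
    by (auto simp: realises_loop_def returns_def run input_word_def)
  have "countable (UNIV :: (bit \<times> nat) set)"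
  proof -
    have "(UNIV :: bit set) = {0, 1}"
      by (auto intro: bit_not_one_iff[THEN iffD1])
    then have "countable (UNIV :: bit set)"
      by (metis countable_empty countable_insert)
    then have "countable ((UNIV :: bit set) \<times> (UNIV :: nat set))"
      by (intro countable_SIGMA) auto
    then show ?thesis
      by simp
  qed
  then have periodic: "countable {e :: nat \<Rightarrow> bit \<times> nat. ultimately_periodic e}"
    by (rule countable_ultimately_periodic)

  have i: "\<exists>e. luroth_expansions c x = {e} \<and> ultimately_periodic e"
    if "\<forall>n. T_iter c \<omega> n x \<notin> switch_region c" for \<omega>
  proof -
    have unique: "trace \<omega>' x = trace \<omega> x" for \<omega>'
      using that by (intro trace_unique \<open>x \<in> X\<close> sign_digit_at_eq_outside_switch_region) (simp add: run)
    then have "luroth_expansions c x = {trace \<omega> x}"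
      by (auto simp: expansions)
    then show ?thesis
      using trace_ultimately_periodic_if_unique[OF \<open>x \<in> X\<close> unique] by blast
  qed
  have ii: "(\<forall>e\<in>luroth_expansions c x. ultimately_periodic e) \<and> countable (luroth_expansions c x)"
    if unique: "\<forall>y\<in>{c..1}. \<forall>u1 u2. is_loop c x y u1 \<and> is_loop c x y u2 \<longrightarrow> loop_equiv c x y u1 u2"
  proof -
    have "ultimately_periodic (trace \<omega> x)" for \<omega>
    proof (rule trace_ultimately_periodic[OF \<open>x \<in> X\<close>])
      fix y n r n' r'
      assume "y \<in> X" and ret: "returns \<omega> x y n r" "returns \<omega> x y n' r'"
      let ?u = "input_word \<omega> n r" and ?u' = "input_word \<omega> n' r'"
      have y: "y \<in> {c..1}"
        using \<open>y \<in> X\<close> by (simp add: X_def)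
      have "is_loop c x y ?u" "is_loop c x y ?u'"
        using y ret unfolding is_loop_def realises by blast+
      then have "loop_equiv c x y ?u ?u'"
        using unique y by blast
      then obtain \<omega>1 n1 r1 \<omega>2 n2 r2 where
        1: "returns \<omega>1 x y n1 r1" "?u = input_word \<omega>1 n1 r1" and
        2: "returns \<omega>2 x y n2 r2" "?u' = input_word \<omega>2 n2 r2" and
        eq: "return_word \<omega>1 x n1 r1 = return_word \<omega>2 x n2 r2"
        unfolding loop_equiv_def realises trace return_word_def by blast
      \<comment> \<open>The realisations supplied by \<open>loop_equiv\<close> need not be the given
        \<open>\<omega>\<close>; the words carry over because they depend only on \<open>y\<close>
        and the loop.\<close>
      have "return_word \<omega> x n r = return_word \<omega>1 x n1 r1"
        using ret(1) 1 by (intro return_word_cong) (auto simp: returns_def)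
      moreover have "return_word \<omega> x n' r' = return_word \<omega>2 x n2 r2"
        using ret(2) 2 by (intro return_word_cong) (auto simp: returns_def)
      ultimately show "return_word \<omega> x n r = return_word \<omega> x n' r'"
        using eq by simp
    qed
    then have "luroth_expansions c x \<subseteq> {e. ultimately_periodic e}"
      by (auto simp: expansions)
    then show ?thesis
      using countable_subset[OF _ periodic] by blast
  qed
  have iii: "uncountable {e \<in> luroth_expansions c x. \<not> ultimately_periodic e} \<and>
        countable {e \<in> luroth_expansions c x. ultimately_periodic e} \<and>
        infinite {e \<in> luroth_expansions c x. ultimately_periodic e}"
    if loops: "is_loop c x y u1" "is_loop c x y u2" "\<not> loop_equiv c x y u1 u2" for y u1 u2
  proof -
    obtain \<omega>1 n1 r1 \<omega>2 n2 r2 where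
      real: "realises_loop c x y u1 \<omega>1 n1 r1" "realises_loop c x y u2 \<omega>2 n2 r2"
      using loops(1,2) unfolding is_loop_def by blast
    \<comment> \<open>Equal strings would witness \<open>loop_equiv\<close>; the condition
      \<open>r1 = r2\<close> demanded there follows by comparing lengths.\<close>
    have "return_word \<omega>1 x n1 r1 \<noteq> return_word \<omega>2 x n2 r2"
    proof
      assume eq: "return_word \<omega>1 x n1 r1 = return_word \<omega>2 x n2 r2"
      then have "length (return_word \<omega>1 x n1 r1) = length (return_word \<omega>2 x n2 r2)"
        by (rule arg_cong)
      then have "r1 = r2"
        by (simp add: return_word_def)
      then show False
        using loops(3) real eq unfolding loop_equiv_def return_word_def trace by blast
    qed
    then interpret two_returns "T c" "sign_digit_at c" X x y \<omega>1 n1 r1 \<omega>2 n2 r2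
      using \<open>x \<in> X\<close> real by unfold_locales (auto simp: realises)
    have count: "countable {e \<in> luroth_expansions c x. ultimately_periodic e}"
      by (rule countable_subset[OF _ periodic]) blast
    \<comment> \<open>Removing countably many ultimately periodic expansions from an uncountable set
      leaves it uncountable.\<close>
    have "uncountable {e \<in> luroth_expansions c x. \<not> ultimately_periodic e}"
    proof
      assume "countable {e \<in> luroth_expansions c x. \<not> ultimately_periodic e}"
      then have "countable ({e \<in> luroth_expansions c x. \<not> ultimately_periodic e} \<union>
          {e \<in> luroth_expansions c x. ultimately_periodic e})"
        using count by (rule countable_Un)
      then have "countable (luroth_expansions c x)"
        by (rule countable_subset[rotated]) blast
      then show False
        using uncountable_traces by (simp add: expansions)
    qed
    then show ?thesis
      using count infinite_ultimately_periodic_traces by (simp add: expansions)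
  qed
  show ?thesis
    by (rule conjI[OF impI conjI[OF impI impI]])
      (erule exE, erule i, erule ii, elim bexE exE conjE, rule iii)
qed

end
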